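(* Let $\widetilde{\varphi}$, $\varphi$, $\widetilde{\varphi}_{(\delta_1,\delta_2,\eta_1,\eta_2)}$ and $\varphi_{(\delta_1,\delta_2,\eta_1,\eta_2)}$ be as defined in the context. (i) The descent $\varphi_{(\delta_1,\delta_2,\eta_1,\eta_2)}$ of a superficially infinitesimal deformation of $\widetilde{\varphi}$ can truly deform $\varphi$: there exist $a_1,a_2,b_1,b_2\in\mathbb{C}$ and $\delta_1,\delta_2,\eta_1,\eta_2\in\mathbb{C}$ such that the image of $\varphi_{(\delta_1,\delta_2,\eta_1,\eta_2)}$, i.e. the closed subscheme of $\mathbb{A}^4=\mathrm{Spec}\,\mathbb{C}[z_1,z_2,z_3,z_4]$ defined by the ideal $\mathrm{Ker}\,\varphi_{(\delta_1,\delta_2,\eta_1,\eta_2)}^{\sharp}$, is not contained in any infinitesimal neighborhood $V((z_1z_2-z_3z_4)^k)$, $k\geq 1$, of the conifold $Y$ in $\mathbb{A}^4$. (ii) Consequently, an appropriate choice of a subspace of the space of morphisms $\widetilde{\varphi}_{(\,\bullet\,)}$ descends to give a space of morphisms $\varphi_{(\,\bullet\,)}$ to $\mathbb{A}^4$ that is parameterized by a deformed conifold. That is, there exist $t\in\mathbb{C}\setminus\{0\}$ and a subvariety $T$ of the parameter space $\mathbb{A}^8$ with coordinates $(a_1,a_2,\delta_1,\delta_2,b_1,b_2,\eta_1,\eta_2)$ such that the set of descents of the morphisms in $T$ is exactly the family $\{\varphi^{(c)} : c\in Y'\}$, where $Y'=\{c=(c_1,c_2,c_3,c_4)\in\mathbb{A}^4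 : c_1c_2-c_3c_4=t\}$ and $\varphi^{(c)}$ is the morphism given by the $\mathbb{C}$-algebra homomorphism $\varphi^{(c),\sharp}:\mathbb{C}[z_1,z_2,z_3,z_4]\to M_2(\mathbb{C})$, $z_i\mapsto\begin{bmatrix} c_i & 0\\ 0&0\end{bmatrix}$, $i=1,2,3,4$.
   Context: Conventions. For an associative unital $\mathbb{C}$-algebra $R$, $\mathrm{Space}\,R$ denotes the formal "noncommutative space" of $R$; a morphism $\varphi:\mathrm{Space}\,R\to\mathrm{Space}\,S$ is by definition a $\mathbb{C}$-algebra homomorphism $\varphi^{\sharp}:S\to R$, and its image is $\mathrm{Space}(S/\mathrm{Ker}\,\varphi^{\sharp})$, regarded as a subspace of $\mathrm{Space}\,S$ (a closed subscheme when $S$ is commutative). Conifold: $Y=\mathrm{Spec}(\mathbb{C}[z_1,z_2,z_3,z_4]/(z_1z_2-z_3z_4))\subset\mathbb{A}^4$. A deformed conifold is a smooth hypersurface $\{z_1z_2-z_3z_4=t\}\subset\mathbb{A}^4$ with $t\neq 0$. Let $\Xi=\mathrm{Space}(R_\Xi)$, where $R_\Xi$ is the quotient of the free associative algebra $\mathbb{C}\langle\xi_1,\xi_2,\xi_3,\xi_4\rangle$ by the two-sided ideal generated by all commutators between pairs of the four elements $\xi_1\xi_3,\ \xi_2\xi_4,\ \xi_1\xi_4,\ \xi_2\xi_3$. Let $\pi^{\Xi}:\Xi\to\mathbb{A}^4$ be given by $\pi^{\Xi,\sharp}: z_1\mapsto\xi_1\xi_3,\ z_2\mapsto\xi_2\xi_4,\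 z_3\mapsto\xi_1\xi_4,\ z_4\mapsto\xi_2\xi_3$. The descent of a morphism $\psi:\mathrm{Space}\,M_2(\mathbb{C})\to\Xi$ is the morphism $\pi^\Xi\circ\psi:\mathrm{Space}\,M_2(\mathbb{C})\to\mathbb{A}^4$, i.e. the ring homomorphism $\psi^\sharp\circ\pi^{\Xi,\sharp}$. Superficially infinitesimal deformation: given a ring homomorphism $h:R\to S$ with $R$ presented by generators $r_1,\dots,r_m$, a superficially infinitesimal deformation of $h$ with respect to these generators is a ring homomorphism $h_\varepsilon:R\to S$ with $h_\varepsilon(r_i)=h(r_i)+\varepsilon_i$, $\varepsilon_i^2=0$, for $i=1,\dots,m$. For $a_1,a_2,b_1,b_2\in\mathbb{C}$, $\widetilde{\varphi}:\mathrm{Space}\,M_2(\mathbb{C})\to\Xi$ is given by $\xi_1,\xi_2,\xi_3,\xi_4\mapsto \begin{bmatrix} a_1&0\\0&0\end{bmatrix},\begin{bmatrix} a_2&0\\0&0\end{bmatrix},\begin{bmatrix} b_1&0\\0&0\end{bmatrix},\begin{bmatrix} b_2&0\\0&0\end{bmatrix}$ respectively; its descent $\varphi$ has image in $Y$. For $\delta_1,\delta_2,\eta_1,\eta_2\in\mathbb{C}$, $\widetilde{\varphi}_{(\delta_1,\delta_2,\eta_1,\eta_2)}$ is the superficially infinitesimal deformation of $\widetilde{\varphi}$ (with respect to $\xi_1,\dots,\xi_4$) given by $\xi_1,\xi_2,\xi_3,\xi_4\mapsto \begin{bmatrix} a_1&\delta_1\\0&0\end{bmatrix},\begin{bmatrix}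 a_2&\delta_2\\0&0\end{bmatrix},\begin{bmatrix} b_1&0\\ \eta_1&0\end{bmatrix},\begin{bmatrix} b_2&0\\ \eta_2&0\end{bmatrix}$ respectively, and $\varphi_{(\delta_1,\delta_2,\eta_1,\eta_2)}$ denotes its descent. The space of all such morphisms $\widetilde{\varphi}_{(\delta_1,\delta_2,\eta_1,\eta_2)}$ (with $a_1,a_2,b_1,b_2$ also varying) is identified with $\mathbb{A}^8$ with coordinates $(a_1,a_2,\delta_1,\delta_2,b_1,b_2,\eta_1,\eta_2)$. *)

theory Defs
  imports
    "HOL-Analysis.Analysis"
    "HOL-Algebra.Module"
    "HOL-Algebra.QuotRing"
    "HOL-Library.Poly_Mapping"
begin

section \<open>Associative unital algebras over the complex numbers\<close>

text \<open>
  An algebra is given by a record of type \<^typ>\<open>(complex, 'a) module\<close>. The locale \<open>algebra\<close> of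
  the library is not applicable, since it requires multiplication to be commutative.
\<close>

locale calgebra = ring A for A :: "(complex, 'a) module" (structure) +
  assumes smult_closed [simp, intro]: "x \<in> carrier A \<Longrightarrow> c \<odot> x \<in> carrier A"
    and smult_l_distr: "x \<in> carrier A \<Longrightarrow> (c + d) \<odot> x = c \<odot> x \<oplus> d \<odot> x"
    and smult_r_distr:
      "\<lbrakk>x \<in> carrier A; y \<in> carrier A\<rbrakk> \<Longrightarrow> c \<odot> (x \<oplus> y) = c \<odot> x \<oplus> c \<odot> y"
    and smult_assoc: "x \<in> carrier A \<Longrightarrow> (c * d) \<odot> x = c \<odot> (d \<odot> x)"
    and smult_one [simp]: "x \<in> carrier A \<Longrightarrow> 1 \<odot> x = x"
    and smult_mult_l:
      "\<lbrakk>x \<in> carrier A; y \<in> carrier A\<rbrakk> \<Longrightarrow> (c \<odot> x) \<otimes> y = c \<odot> (x \<otimes> y)"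
    and smult_mult_r:
      "\<lbrakk>x \<in> carrier A; y \<in> carrier A\<rbrakk> \<Longrightarrow> x \<otimes> (c \<odot> y) = c \<odot> (x \<otimes> y)"

definition calg_hom :: "(complex, 'a) module \<Rightarrow> (complex, 'b) module \<Rightarrow> ('a \<Rightarrow> 'b) set"
  where "calg_hom A B =
    {h \<in> ring_hom A B. \<forall>c. \<forall>x\<in>carrier A. h (c \<odot>\<^bsub>A\<^esub> x) = c \<odot>\<^bsub>B\<^esub> h x}"

definition calg_quot :: "(complex, 'a) module \<Rightarrow> 'a set \<Rightarrow> (complex, 'a set) module"
  where "calg_quot A I = ring.extend (A Quot I)
    (module.fields (\<lambda>c X. \<Union>x\<in>X. I +>\<^bsub>A\<^esub> (c \<odot>\<^bsub>A\<^esub> x)))"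

definition calg_generated_by :: "(complex, 'a) module \<Rightarrow> 'a set \<Rightarrow> bool"
  where "calg_generated_by A G \<longleftrightarrow> G \<subseteq> carrier A \<and>
    (\<forall>H. G \<subseteq> H \<and> H \<subseteq> carrier A \<and> \<one>\<^bsub>A\<^esub> \<in> H \<and>
      (\<forall>x\<in>H. \<forall>y\<in>H. x \<oplus>\<^bsub>A\<^esub> y \<in> H \<and> x \<otimes>\<^bsub>A\<^esub> y \<in> H) \<and>
      (\<forall>c. \<forall>x\<in>H. c \<odot>\<^bsub>A\<^esub> x \<in> H) \<longrightarrow> H = carrier A)"

text \<open>
  A morphism \<open>Space R \<rightarrow> Space S\<close> is an element of \<open>calg_hom S R\<close>. The closed
  subspace of \<open>Space S\<close> cut out by a two-sided ideal \<open>I\<close> is represented by \<open>I\<close>; its function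
  algebra is \<open>S/I\<close>. Containment of \<open>V(I)\<close> in \<open>V(J)\<close> means that the inclusion of \<open>V(I)\<close> into
  \<open>Space S\<close> factors through that of \<open>V(J)\<close>, that is, that the projection \<open>S \<rightarrow> S/I\<close> factors
  through \<open>S \<rightarrow> S/J\<close>.
\<close>

definition subspace_contained :: "(complex, 'a) module \<Rightarrow> 'a set \<Rightarrow> 'a set \<Rightarrow> bool"
  where "subspace_contained S I J \<longleftrightarrow>
    (\<exists>h \<in> calg_hom (calg_quot S J) (calg_quot S I).
       \<forall>x\<in>carrier S. h (J +>\<^bsub>S\<^esub> x) = I +>\<^bsub>S\<^esub> x)"

text \<open>The image of \<open>\<phi> : Space R \<rightarrow> Space S\<close>, as a closed subspace of \<open>Space S\<close>.\<close>

definition image_ideal :: "(complex, 'a) module \<Rightarrow> (complex, 'b) module \<Rightarrow> ('a \<Rightarrow> 'b) \<Rightarrow> 'a set"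
  where "image_ideal S R \<phi> = a_kernel S R \<phi>"

definition superficially_infinitesimal_deformation ::
    "(complex, 'a) module \<Rightarrow> (complex, 'b) module \<Rightarrow> ('i \<Rightarrow> 'a) \<Rightarrow> ('a \<Rightarrow> 'b) \<Rightarrow> ('a \<Rightarrow> 'b) \<Rightarrow> bool"
  where "superficially_infinitesimal_deformation R S r h h' \<longleftrightarrow>
    calg_generated_by R (range r) \<and> h \<in> calg_hom R S \<and> h' \<in> calg_hom R S \<and>
    (\<forall>i. \<exists>\<epsilon>\<in>carrier S. h' (r i) = h (r i) \<oplus>\<^bsub>S\<^esub> \<epsilon> \<and> \<epsilon> \<otimes>\<^bsub>S\<^esub> \<epsilon> = \<zero>\<^bsub>S\<^esub>)"


section \<open>Monoid algebras: polynomials and noncommutative polynomials\<close>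

text \<open>
  The type \<^typ>\<open>'m \<Rightarrow>\<^sub>0 complex\<close> is the algebra of the additively written monoid \<^typ>\<open>'m\<close>, with
  convolution as multiplication. Taking \<open>'m\<close> to be the exponent vectors \<^typ>\<open>'v \<Rightarrow>\<^sub>0 nat\<close>
  yields polynomials in commuting variables \<open>'v\<close>; taking \<open>'m\<close> to be the words in \<open>'v\<close> yields the
  free associative algebra on \<open>'v\<close>.
\<close>

datatype 'v free_mon = Word (letters: "'v list")

instantiation free_mon :: (type) monoid_add
begin
definition zero_free_mon :: "'a free_mon" where "0 = Word []"
definition plus_free_mon :: "'a free_mon \<Rightarrow> 'a free_mon \<Rightarrow> 'a free_mon"
  where "u + v = Word (letters u @ letters v)"
instance by standard (auto simp: zero_free_mon_def plus_free_mon_def)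
end

definition monoid_alg :: "(complex, 'm::monoid_add \<Rightarrow>\<^sub>0 complex) module"
  where "monoid_alg = \<lparr>carrier = UNIV, mult = (*), one = 1, zero = 0, add = (+),
    smult = (\<lambda>c F. Poly_Mapping.single 0 c * F)\<rparr>"

text \<open>The linear extension of a map from the monoid to an algebra.\<close>

definition monoid_alg_lift ::
    "(complex, 'b) module \<Rightarrow> ('m \<Rightarrow> 'b) \<Rightarrow> ('m::monoid_add \<Rightarrow>\<^sub>0 complex) \<Rightarrow> 'b"
  where "monoid_alg_lift A \<mu> F = (\<Oplus>\<^bsub>A\<^esub>m\<in>Poly_Mapping.keys F. Poly_Mapping.lookup F m \<odot>\<^bsub>A\<^esub> \<mu> m)"

text \<open>
  Indices range over the numeral type \<open>4\<close>, whose elements are \<open>1, 2, 3, 4\<close> (with \<open>4 = 0\<close>).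
\<close>

type_synonym free4 = "4 free_mon \<Rightarrow>\<^sub>0 complex"
type_synonym poly4 = "(4 \<Rightarrow>\<^sub>0 nat) \<Rightarrow>\<^sub>0 complex"

abbreviation Free4 :: "(complex, free4) module" where "Free4 \<equiv> monoid_alg"
abbreviation Poly4 :: "(complex, poly4) module" where "Poly4 \<equiv> monoid_alg"

definition X :: "4 \<Rightarrow> free4" where "X i = Poly_Mapping.single (Word [i]) 1"
definition Z :: "4 \<Rightarrow> poly4" where "Z i = Poly_Mapping.single (Poly_Mapping.single i 1) 1"

definition free4_hom :: "(complex, 'b) module \<Rightarrow> (4 \<Rightarrow> 'b) \<Rightarrow> free4 \<Rightarrow> 'b"
  where "free4_hom A g =
    monoid_alg_lift A (\<lambda>w. foldr (\<lambda>i y. g i \<otimes>\<^bsub>A\<^esub> y) (letters w) \<one>\<^bsub>A\<^esub>)"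

text \<open>
  The homomorphism \<open>Z i \<mapsto> g i\<close>; the target may be noncommutative, but the elements \<open>g i\<close> are meant
  to commute with each other.
\<close>

definition poly4_hom :: "(complex, 'b) module \<Rightarrow> (4 \<Rightarrow> 'b) \<Rightarrow> poly4 \<Rightarrow> 'b"
  where "poly4_hom A g = monoid_alg_lift A (\<lambda>m.
    g 1 [^]\<^bsub>A\<^esub> Poly_Mapping.lookup m 1 \<otimes>\<^bsub>A\<^esub> g 2 [^]\<^bsub>A\<^esub> Poly_Mapping.lookup m 2 \<otimes>\<^bsub>A\<^esub>
    g 3 [^]\<^bsub>A\<^esub> Poly_Mapping.lookup m 3 \<otimes>\<^bsub>A\<^esub> g 4 [^]\<^bsub>A\<^esub> Poly_Mapping.lookup m 4)"

definition conifold_eq :: poly4 where "conifold_eq = Z 1 * Z 2 - Z 3 * Z 4"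

text \<open>The \<open>k\<close>-th infinitesimal neighbourhood \<open>V((z\<^sub>1z\<^sub>2 - z\<^sub>3z\<^sub>4)\<^sup>k)\<close> of the conifold.\<close>

definition conifold_nbhd_ideal :: "nat \<Rightarrow> poly4 set"
  where "conifold_nbhd_ideal k = Idl\<^bsub>Poly4\<^esub> {conifold_eq ^ k}"


section \<open>The space \<open>\<Xi>\<close> and its projection to affine 4-space\<close>

definition Xi_prods :: "free4 set"
  where "Xi_prods = {X 1 * X 3, X 2 * X 4, X 1 * X 4, X 2 * X 3}"

definition Xi_ideal :: "free4 set"
  where "Xi_ideal = Idl\<^bsub>Free4\<^esub> {x * y - y * x | x y. x \<in> Xi_prods \<and> y \<in> Xi_prods}"

definition R_Xi :: "(complex, free4 set) module"
  where "R_Xi = calg_quot Free4 Xi_ideal"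

definition \<xi> :: "4 \<Rightarrow> free4 set" where "\<xi> i = Xi_ideal +>\<^bsub>Free4\<^esub> X i"

text \<open>
  The homomorphism \<open>\<xi> i \<mapsto> g i\<close> out of \<open>R_Xi\<close>: on a coset, it takes the common value of
  \<open>free4_hom A g\<close> on its representatives.
\<close>

definition Xi_hom :: "(complex, 'b) module \<Rightarrow> (4 \<Rightarrow> 'b) \<Rightarrow> free4 set \<Rightarrow> 'b"
  where "Xi_hom A g C = the_elem (free4_hom A g ` C)"

definition \<pi>_Xi :: "poly4 \<Rightarrow> free4 set"
  where "\<pi>_Xi = poly4_hom R_Xi (\<lambda>i.
    if i = 1 then \<xi> 1 \<otimes>\<^bsub>R_Xi\<^esub> \<xi> 3
    else if i = 2 then \<xi> 2 \<otimes>\<^bsub>R_Xi\<^esub> \<xi> 4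
    else if i = 3 then \<xi> 1 \<otimes>\<^bsub>R_Xi\<^esub> \<xi> 4
    else \<xi> 2 \<otimes>\<^bsub>R_Xi\<^esub> \<xi> 3)"

definition descent :: "(free4 set \<Rightarrow> 'b) \<Rightarrow> poly4 \<Rightarrow> 'b"
  where "descent \<psi> = \<psi> \<circ> \<pi>_Xi"


section \<open>Morphisms from the space of 2 by 2 matrices\<close>

text \<open>The instance of \<open>*\<close> for \<^typ>\<open>complex^2^2\<close> is componentwise; the matrix product is \<open>**\<close>.\<close>

definition M2 :: "(complex, complex^2^2) module"
  where "M2 = \<lparr>carrier = UNIV, mult = (**), one = mat 1, zero = 0, add = (+),
    smult = (\<lambda>c m. \<chi> i j. c * m $ i $ j)\<rparr>"

definition mat2 :: "complex \<Rightarrow> complex \<Rightarrow> complex \<Rightarrow> complex \<Rightarrow> complex^2^2"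
  where "mat2 a b c d = vector [vector [a, b], vector [c, d]]"

definition \<phi>t_deformed ::
    "complex \<Rightarrow> complex \<Rightarrow> complex \<Rightarrow> complex \<Rightarrow> complex \<Rightarrow> complex \<Rightarrow> complex \<Rightarrow> complex
      \<Rightarrow> free4 set \<Rightarrow> complex^2^2"
  where "\<phi>t_deformed a1 a2 \<delta>1 \<delta>2 b1 b2 \<eta>1 \<eta>2 = Xi_hom M2 (\<lambda>i.
    if i = 1 then mat2 a1 \<delta>1 0 0
    else if i = 2 then mat2 a2 \<delta>2 0 0
    else if i = 3 then mat2 b1 0 \<eta>1 0
    else mat2 b2 0 \<eta>2 0)"

definition \<phi>t :: "complex \<Rightarrow> complex \<Rightarrow> complex \<Rightarrow> complex \<Rightarrow> free4 set \<Rightarrow> complex^2^2"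
  where "\<phi>t a1 a2 b1 b2 = Xi_hom M2 (\<lambda>i.
    if i = 1 then mat2 a1 0 0 0
    else if i = 2 then mat2 a2 0 0 0
    else if i = 3 then mat2 b1 0 0 0
    else mat2 b2 0 0 0)"

text \<open>The coordinates of affine 8-space are \<open>(a\<^sub>1, a\<^sub>2, \<delta>\<^sub>1, \<delta>\<^sub>2, b\<^sub>1, b\<^sub>2, \<eta>\<^sub>1, \<eta>\<^sub>2)\<close>, in this order.\<close>

definition \<phi>t_at :: "complex^8 \<Rightarrow> free4 set \<Rightarrow> complex^2^2"
  where "\<phi>t_at p = \<phi>t_deformed (p$1) (p$2) (p$3) (p$4) (p$5) (p$6) (p$7) (p$8)"

definition \<phi>_const :: "complex^4 \<Rightarrow> poly4 \<Rightarrow> complex^2^2"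
  where "\<phi>_const c = poly4_hom M2 (\<lambda>i. mat2 (c$i) 0 0 0)"

definition deformed_conifold :: "complex \<Rightarrow> (complex^4) set"
  where "deformed_conifold t = {c. c$1 * c$2 - c$3 * c$4 = t}"


section \<open>Subvarieties of affine space\<close>

definition poly_value :: "(('n::finite \<Rightarrow>\<^sub>0 nat) \<Rightarrow>\<^sub>0 complex) \<Rightarrow> complex^'n \<Rightarrow> complex"
  where "poly_value P x = (\<Sum>m\<in>Poly_Mapping.keys P. Poly_Mapping.lookup P m * (\<Prod>i\<in>UNIV. x$i ^ Poly_Mapping.lookup m i))"

text \<open>A subvariety is an irreducible Zariski closed subset.\<close>

definition zariski_closed :: "(complex^'n::finite) set \<Rightarrow> bool"
  where "zariski_closed T \<longleftrightarrow> (\<exists>E. T = {x. \<forall>P\<in>E. poly_value P x = 0})"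

definition subvariety :: "(complex^'n::finite) set \<Rightarrow> bool"
  where "subvariety T \<longleftrightarrow> zariski_closed T \<and> T \<noteq> {} \<and>
    (\<forall>T1 T2. zariski_closed T1 \<and> zariski_closed T2 \<and> T \<subseteq> T1 \<union> T2 \<longrightarrow> T \<subseteq> T1 \<or> T \<subseteq> T2)"


section \<open>The algebras and homomorphisms above are well defined\<close>

lemma monoid_alg_simps [simp]:
  "carrier monoid_alg = UNIV" "mult monoid_alg = (*)" "one monoid_alg = 1"
  "zero monoid_alg = 0" "add monoid_alg = (+)"
  "smult monoid_alg c F = Poly_Mapping.single 0 c * F"
  by (simp_all add: monoid_alg_def)

lemma M2_simps [simp]:
  "carrier M2 = UNIV" "mult M2 = (**)" "one M2 = mat 1"
  "zero M2 = 0" "add M2 = (+)"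
  "smult M2 c m = (\<chi> i j. c * m $ i $ j)"
  by (simp_all add: M2_def)

lemma calg_quot_simps [simp]:
  "carrier (calg_quot A I) = carrier (A Quot I)" "mult (calg_quot A I) = mult (A Quot I)"
  "one (calg_quot A I) = one (A Quot I)" "zero (calg_quot A I) = zero (A Quot I)"
  "add (calg_quot A I) = add (A Quot I)"
  "smult (calg_quot A I) c Y = (\<Union>x\<in>Y. I +>\<^bsub>A\<^esub> (c \<odot>\<^bsub>A\<^esub> x))"
  by (simp_all add: calg_quot_def ring.defs module.defs)

lemma poly_mapping_induct_single [case_names zero add]:
  fixes F :: "'m \<Rightarrow>\<^sub>0 'c::comm_monoid_add"
  assumes "P 0" "\<And>k v f. P f \<Longrightarrow> P (Poly_Mapping.single k v + f)"
  shows "P F"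
proof (induction F rule: update_induct)
  case const
  then show ?case by (rule assms)
next
  case (update f a b)
  have "Poly_Mapping.update a b f = Poly_Mapping.single a b + f"
    using update(1)
    by (intro poly_mapping_eqI) (auto simp: lookup_update lookup_add lookup_single not_in_keys_iff_lookup_eq_zero)
  then show ?case using assms(2)[OF update(3)] by simp
qed

lemma single_0_commute:
  fixes F :: "'m::monoid_add \<Rightarrow>\<^sub>0 complex"
  shows "F * Poly_Mapping.single 0 c = Poly_Mapping.single 0 c * F"
  by (induction F rule: poly_mapping_induct_single)
    (auto simp: mult_single mult.commute algebra_simps)

lemma calgebra_monoid_alg: "calgebra (monoid_alg :: (complex, 'm::monoid_add \<Rightarrow>\<^sub>0 complex) module)"
proof -
  have inv: "\<exists>y. x + y = 0" for x :: "'m \<Rightarrow>\<^sub>0 complex"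
    by (rule exI[of _ "-x"]) simp
  have assoc: "Poly_Mapping.single 0 (c * d) * x = Poly_Mapping.single 0 c * (Poly_Mapping.single 0 d * x)"
    for c d and x :: "'m \<Rightarrow>\<^sub>0 complex"
    by (simp only: mult_single mult.assoc[symmetric] add_0)
  have comm: "x * (Poly_Mapping.single 0 c * y) = Poly_Mapping.single 0 c * (x * y)"
    for c and x y :: "'m \<Rightarrow>\<^sub>0 complex"
  proof -
    have "x * (Poly_Mapping.single 0 c * y) = (x * Poly_Mapping.single 0 c) * y" by (simp only: mult.assoc)
    also have "\<dots> = Poly_Mapping.single 0 c * (x * y)" by (simp only: single_0_commute mult.assoc)
    finally show ?thesis .
  qed
  have "ring (monoid_alg :: (complex, 'm \<Rightarrow>\<^sub>0 complex) module)"
    by (intro ringI abelian_groupI monoidI)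
      (simp_all add: add.left_commute add.commute mult.assoc distrib_left
        distrib_right inv)
  then show ?thesis
  proof (rule calgebra.intro, intro calgebra_axioms.intro)
    fix c d and x y :: "'m \<Rightarrow>\<^sub>0 complex"
    show "(c * d) \<odot>\<^bsub>monoid_alg\<^esub> x = c \<odot>\<^bsub>monoid_alg\<^esub> (d \<odot>\<^bsub>monoid_alg\<^esub> x)"
      using assoc[of c d x] by simp
    show "x \<otimes>\<^bsub>monoid_alg\<^esub> (c \<odot>\<^bsub>monoid_alg\<^esub> y) = c \<odot>\<^bsub>monoid_alg\<^esub> (x \<otimes>\<^bsub>monoid_alg\<^esub> y)"
      using comm[of x c y] by simp
  qed (simp_all add: single_add distrib_left distrib_right mult.assoc)
qed

lemma calgebra_M2: "calgebra M2"
proof -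
  have inv: "\<exists>y. y + x = 0" for x :: "complex^2^2"
    by (rule exI[of _ "-x"]) simp
  have rdist: "(x + y) ** z = x ** z + y ** z" for x y z :: "complex^2^2"
    by (simp add: matrix_matrix_mult_def vec_eq_iff sum.distrib distrib_right)
  have "ring M2"
    by (intro ringI abelian_groupI monoidI)
      (simp_all add: inv matrix_mul_assoc matrix_add_ldistrib rdist)
  then show ?thesis
    by (rule calgebra.intro, unfold_locales)
      (auto simp: vec_eq_iff matrix_matrix_mult_def sum_distrib_left algebra_simps)
qed

context calgebra
begin

lemma smult_zero_l [simp]: "x \<in> carrier A \<Longrightarrow> 0 \<odot> x = \<zero>"
  using smult_l_distr[of x 0 0] add.l_cancel_one'[of "0 \<odot> x" "0 \<odot> x"] by simp

lemma ideal_smult: "ideal I A \<Longrightarrow> x \<in> I \<Longrightarrow> c \<odot> x \<in> I"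
proof -
  assume I: "ideal I A" "x \<in> I"
  then have x: "x \<in> carrier A" by (meson additive_subgroup.a_Hcarr ideal.axioms(1))
  have "(c \<odot> \<one>) \<otimes> x \<in> I" using I by (simp add: ideal.I_l_closed)
  then show ?thesis using x by (simp add: smult_mult_l)
qed

lemma quot_smult:
  assumes "ideal I A" "y \<in> carrier A"
  shows "c \<odot>\<^bsub>calg_quot A I\<^esub> (I +> y) = I +> c \<odot> y"
proof -
  interpret I: ideal I A by fact
  have "I +> c \<odot> x = I +> c \<odot> y" if x: "x \<in> I +> y" for x
  proof -
    obtain i where i: "i \<in> I" "x = i \<oplus> y" using x by (auto simp: a_r_coset_def')
    have "c \<odot> x = c \<odot> i \<oplus> c \<odot> y" using i assms by (simp add: smult_r_distr I.a_Hcarr)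
    moreover have "c \<odot> i \<in> I" using i assms ideal_smult by blast
    ultimately have "c \<odot> x \<in> I +> c \<odot> y" by (auto simp: a_r_coset_def')
    from a_repr_independence[OF this smult_closed[OF assms(2)] I.a_subgroup]
    show ?thesis by simp
  qed
  then have "(\<Union>x\<in>I +> y. I +> c \<odot> x) = (\<Union>x\<in>I +> y. I +> c \<odot> y)" by (rule SUP_cong[OF refl])
  moreover have "y \<in> I +> y" using assms by (simp add: I.a_rcos_self)
  ultimately show ?thesis unfolding calg_quot_simps by (metis SUP_const empty_iff)
qed

lemma quot_carrier: "carrier (A Quot I) = (\<lambda>x. I +> x) ` carrier A"
  by (auto simp: FactRing_simps)

lemma calgebra_quot:
  assumes "ideal I A"
  shows "calgebra (calg_quot A I)"
proof -
  interpret I: ideal I A by fact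
  interpret Q: ring "A Quot I" by (rule I.quotient_is_ring)
  have car: "carrier (A Quot I) = (\<lambda>x. I +> x) ` carrier A"
    by (auto simp: FactRing_simps)
  have add: "(I +> x) \<oplus>\<^bsub>A Quot I\<^esub> (I +> y) = I +> (x \<oplus> y)"
    and mult: "(I +> x) \<otimes>\<^bsub>A Quot I\<^esub> (I +> y) = I +> (x \<otimes> y)"
    if "x \<in> carrier A" "y \<in> carrier A" for x y
    using that by (auto simp: FactRing_simps I.a_rcos_sum I.rcoset_mult_add)
  have "ring (calg_quot A I)"
  proof (intro ringI abelian_groupI monoidI)
    fix x assume "x \<in> carrier (calg_quot A I)"
    then show "\<exists>y\<in>carrier (calg_quot A I). y \<oplus>\<^bsub>calg_quot A I\<^esub> x = \<zero>\<^bsub>calg_quot A I\<^esub>"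
      by (intro bexI[of _ "\<ominus>\<^bsub>A Quot I\<^esub> x"]) (simp_all add: Q.l_neg)
  qed (simp_all add: Q.a_assoc Q.m_assoc Q.l_distr Q.r_distr Q.a_comm Q.a_lcomm)
  then show ?thesis
    apply (rule calgebra.intro)
    apply unfold_locales
    apply (auto simp del: calg_quot_simps(6) simp: car quot_smult[OF assms] add mult
       smult_l_distr smult_r_distr smult_assoc smult_mult_l smult_mult_r)
    done
qed

lemma quot_hom: "ideal I A \<Longrightarrow> (\<lambda>x. I +> x) \<in> calg_hom A (calg_quot A I)"
  using ideal.rcos_ring_hom[of I A] quot_smult[of I]
  by (auto simp del: calg_quot_simps(6) simp: calg_hom_def ring_hom_def)

lemma lift_superset:
  assumes "\<mu> \<in> UNIV \<rightarrow> carrier A" "finite S" "Poly_Mapping.keys F \<subseteq> S"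
  shows "monoid_alg_lift A \<mu> F = (\<Oplus>m\<in>S. Poly_Mapping.lookup F m \<odot> \<mu> m)"
  unfolding monoid_alg_lift_def
  using assms by (intro add.finprod_mono_neutral_cong_left) (auto simp: in_keys_iff Pi_iff)

lemma lift_closed: "\<mu> \<in> UNIV \<rightarrow> carrier A \<Longrightarrow> monoid_alg_lift A \<mu> F \<in> carrier A"
  unfolding monoid_alg_lift_def by (auto intro!: finsum_closed)

lemma lift_add:
  assumes "\<mu> \<in> UNIV \<rightarrow> carrier A"
  shows "monoid_alg_lift A \<mu> (F + G) = monoid_alg_lift A \<mu> F \<oplus> monoid_alg_lift A \<mu> G"
proof -
  let ?S = "Poly_Mapping.keys F \<union> Poly_Mapping.keys G"
  have mu: "\<mu> m \<in> carrier A" for m using assms by auto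
  have "monoid_alg_lift A \<mu> H = (\<Oplus>m\<in>?S. Poly_Mapping.lookup H m \<odot> \<mu> m)"
    if "Poly_Mapping.keys H \<subseteq> ?S" for H using that assms by (intro lift_superset) auto
  from this[of F] this[of G] this[of "F + G"] show ?thesis
    using Poly_Mapping.keys_add[of F G] mu
    by (auto simp: lookup_add smult_l_distr finsum_addf)
qed

lemma lift_single:
  "\<mu> \<in> UNIV \<rightarrow> carrier A \<Longrightarrow> monoid_alg_lift A \<mu> (Poly_Mapping.single k v) = v \<odot> \<mu> k"
  using lift_superset[of \<mu> "{k}" "Poly_Mapping.single k v"] by (simp add: Pi_iff)

lemma lift_zero: "monoid_alg_lift A \<mu> 0 = \<zero>"
  by (simp add: monoid_alg_lift_def)

lemma lift_hom:
  assumes \<mu>: "\<mu> \<in> UNIV \<rightarrow> carrier A" "\<mu> 0 = \<one>" "\<And>s t. \<mu> (s + t) = \<mu> s \<otimes> \<mu> t"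
  shows "monoid_alg_lift A \<mu> \<in> calg_hom monoid_alg A"
proof -
  let ?L = "monoid_alg_lift A \<mu>"
  note cl = lift_closed[OF \<mu>(1)]
  have mu: "\<mu> m \<in> carrier A" for m using \<mu> by auto
  have sm: "?L (Poly_Mapping.single k v * G) = ?L (Poly_Mapping.single k v) \<otimes> ?L G" for k v G
    by (induction G rule: poly_mapping_induct_single)
      (auto simp: lift_zero mult_single distrib_left lift_add[OF \<mu>(1)] lift_single[OF \<mu>(1)] cl mu
        \<mu>(3) r_distr smult_mult_l smult_mult_r smult_assoc[symmetric] mult.commute)
  have m: "?L (F * G) = ?L F \<otimes> ?L G" for F G
    by (induction F rule: poly_mapping_induct_single)
      (auto simp: lift_zero distrib_right lift_add[OF \<mu>(1)] sm l_distr cl)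
  have "?L 1 = \<one>" using lift_single[OF \<mu>(1), of 0 1] \<mu>(2) by simp
  moreover have "?L (Poly_Mapping.single 0 c * F) = c \<odot> ?L F" for c F
    by (simp add: m lift_single[OF \<mu>(1)] \<mu>(2) smult_mult_l cl)
  ultimately show ?thesis
    by (auto simp: calg_hom_def ring_hom_def cl m lift_add[OF \<mu>(1)])
qed

lemma free4_hom:
  assumes "g \<in> UNIV \<rightarrow> carrier A"
  shows "free4_hom A g \<in> calg_hom Free4 A" "free4_hom A g (X i) = g i"
proof -
  let ?\<mu> = "\<lambda>w. foldr (\<lambda>i y. g i \<otimes> y) (letters w) \<one>"
  have g: "g i \<in> carrier A" for i using assms by auto
  have c: "foldr (\<lambda>i y. g i \<otimes> y) w \<one> \<in> carrier A" for w by (induction w) (auto simp: g)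
  have a: "foldr (\<lambda>i y. g i \<otimes> y) (v @ w) \<one> = foldr (\<lambda>i y. g i \<otimes> y) v \<one> \<otimes> foldr (\<lambda>i y. g i \<otimes> y) w \<one>" for v w
  proof (induction v)
    case (Cons i v)
    show ?case using Cons c[of v] c[of w] g[of i]
      by (simp add: m_assoc del: foldr_append)
  qed (use c[of w] in simp)
  show "free4_hom A g \<in> calg_hom Free4 A"
    unfolding free4_hom_def using c a
    by (intro lift_hom) (auto simp: zero_free_mon_def plus_free_mon_def simp del: foldr_append)
  show "free4_hom A g (X i) = g i"
    unfolding free4_hom_def X_def using c g by (subst lift_single) auto
qed

lemma poly4_hom:
  assumes "g \<in> UNIV \<rightarrow> carrier A" and comm: "\<And>i j. g i \<otimes> g j = g j \<otimes> g i"
  shows "poly4_hom A g \<in> calg_hom Poly4 A" "poly4_hom A g (Z i) = g i"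
proof -
  let ?\<mu> = "\<lambda>m :: 4 \<Rightarrow>\<^sub>0 nat. g 1 [^] Poly_Mapping.lookup m 1 \<otimes> g 2 [^] Poly_Mapping.lookup m 2 \<otimes>
    g 3 [^] Poly_Mapping.lookup m 3 \<otimes> g 4 [^] Poly_Mapping.lookup m 4"
  have g [simp]: "g i \<in> carrier A" for i using assms by auto
  have c1: "x [^] (n::nat) \<otimes> y = y \<otimes> x [^] n"
    if "x \<in> carrier A" "y \<in> carrier A" "x \<otimes> y = y \<otimes> x" for x y n
  proof (induction n)
    case (Suc n)
    have "x [^] Suc n \<otimes> y = x [^] n \<otimes> (x \<otimes> y)" using that by (simp add: m_assoc)
    also have "\<dots> = (x [^] n \<otimes> y) \<otimes> x" using that by (simp add: m_assoc)
    also have "\<dots> = y \<otimes> x [^] Suc n" using Suc that by (simp add: m_assoc)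
    finally show ?case .
  qed (use that in simp)
  have c: "g i [^] (n::nat) \<otimes> g j [^] (k::nat) = g j [^] k \<otimes> g i [^] n" for i j n k
    by (rule c1[OF g nat_pow_closed[OF g] c1[OF g g comm, symmetric]])
  have lc: "x \<otimes> (y \<otimes> z) = y \<otimes> (x \<otimes> z)"
    if "x \<otimes> y = y \<otimes> x" "x \<in> carrier A" "y \<in> carrier A" "z \<in> carrier A" for x y z
    using that by (metis m_assoc)
  have mu: "?\<mu> \<in> UNIV \<rightarrow> carrier A" by auto
  have sh: "(a \<otimes> a') \<otimes> (b \<otimes> b') \<otimes> (d \<otimes> d') \<otimes> (e \<otimes> e') = (a \<otimes> b \<otimes> d \<otimes> e) \<otimes> (a' \<otimes> b' \<otimes> d' \<otimes> e')"
    if "{a, a', b, b', d, d', e, e'} \<subseteq> carrier A"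
      "a' \<otimes> b = b \<otimes> a'" "a' \<otimes> d = d \<otimes> a'" "a' \<otimes> e = e \<otimes> a'"
      "b' \<otimes> d = d \<otimes> b'" "b' \<otimes> e = e \<otimes> b'" "d' \<otimes> e = e \<otimes> d'"
    for a a' b b' d d' e e'
    using that lc[of a' b] lc[of a' d] lc[of a' e] lc[of b' d] lc[of b' e] lc[of d' e]
    by (simp add: m_assoc)
  have mult: "?\<mu> (s + t) = ?\<mu> s \<otimes> ?\<mu> t" for s t
    unfolding lookup_add nat_pow_mult[OF g, symmetric] by (rule sh) (auto intro: c)
  show "poly4_hom A g \<in> calg_hom Poly4 A"
    unfolding poly4_hom_def using mu mult by (intro lift_hom) auto
  show "poly4_hom A g (Z i) = g i"
    unfolding poly4_hom_def Z_def using exhaust_4[of i]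
    by (subst lift_single[OF mu]) (auto simp: lookup_single)
qed

lemma the_elem_coset:
  assumes I: "ideal I A" and h: "h \<in> calg_hom A B" and k: "\<And>x. x \<in> I \<Longrightarrow> h x = \<zero>\<^bsub>B\<^esub>"
    and B: "calgebra B" and x: "x \<in> carrier A"
  shows "the_elem (h ` (I +> x)) = h x"
proof -
  interpret I: ideal I A by fact
  interpret B: calgebra B by fact
  have "h y = h x" if y: "y \<in> I +> x" for y
  proof -
    obtain i where i: "i \<in> I" "y = i \<oplus> x" using y by (auto simp: a_r_coset_def')
    then have "h y = h i \<oplus>\<^bsub>B\<^esub> h x" using h x by (auto simp: calg_hom_def ring_hom_def I.a_Hcarr)
    then show ?thesis using k[OF i(1)] h x by (auto simp: calg_hom_def ring_hom_def Pi_iff)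
  qed
  then have "h ` (I +> x) \<subseteq> {h x}" by blast
  moreover have "x \<in> I +> x" using x by (simp add: I.a_rcos_self)
  ultimately have "h ` (I +> x) = {h x}" by blast
  then show ?thesis by simp
qed

end

interpretation Free4: calgebra Free4 by (rule calgebra_monoid_alg)

interpretation M2: calgebra M2 by (rule calgebra_M2)

lemma Xi_ideal: "ideal Xi_ideal Free4"
  unfolding Xi_ideal_def by (rule Free4.genideal_ideal) auto

interpretation R_Xi: calgebra R_Xi
  unfolding R_Xi_def by (rule calgebra.calgebra_quot[OF calgebra_monoid_alg Xi_ideal])

lemma Xi_quot_hom: "(\<lambda>x. Xi_ideal +>\<^bsub>Free4\<^esub> x) \<in> calg_hom Free4 R_Xi"
  unfolding R_Xi_def by (rule calgebra.quot_hom[OF calgebra_monoid_alg Xi_ideal])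

lemma carrier_R_Xi: "carrier R_Xi = range (\<lambda>x. Xi_ideal +>\<^bsub>Free4\<^esub> x)"
  unfolding R_Xi_def calg_quot_simps Free4.quot_carrier by simp

lemma free4_hom_Xi_ideal:
  assumes B: "calgebra B" and g: "g \<in> UNIV \<rightarrow> carrier B"
    and comm: "\<And>x y. x \<in> Xi_prods \<Longrightarrow> y \<in> Xi_prods \<Longrightarrow>
      free4_hom B g x \<otimes>\<^bsub>B\<^esub> free4_hom B g y = free4_hom B g y \<otimes>\<^bsub>B\<^esub> free4_hom B g x"
    and x: "x \<in> Xi_ideal"
  shows "free4_hom B g x = \<zero>\<^bsub>B\<^esub>"
proof -
  interpret B: calgebra B by fact
  let ?h = "free4_hom B g"
  have h: "?h \<in> calg_hom Free4 B" using B.free4_hom g by blast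
  then have "?h \<in> ring_hom Free4 B" unfolding calg_hom_def by blast
  then interpret h: ring_hom_ring Free4 B ?h
    by (rule ring_hom_ringI2[OF Free4.ring_axioms B.ring_axioms])
  have id: "ideal (a_kernel Free4 B ?h) Free4" by (rule h.kernel_is_ideal)
  have hc: "?h x \<in> carrier B" for x using h.hom_closed[of x] by simp
  have "?h (x * y - y * x) = \<zero>\<^bsub>B\<^esub>" if "x \<in> Xi_prods" "y \<in> Xi_prods" for x y
  proof -
    have a: "?h (u + v) = ?h u \<oplus>\<^bsub>B\<^esub> ?h v" and m: "?h (u * v) = ?h u \<otimes>\<^bsub>B\<^esub> ?h v" for u v
      using h by (simp_all add: calg_hom_def ring_hom_def)
    have "?h (y * x) = ?h (x * y)" unfolding m by (rule comm[OF that(2,1)])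
    also have "\<dots> = ?h ((x * y - y * x) + y * x)" by (simp only: diff_add_cancel)
    also have "\<dots> = ?h (x * y - y * x) \<oplus>\<^bsub>B\<^esub> ?h (y * x)" by (rule a)
    finally show ?thesis
      using B.add.r_cancel_one'[OF hc[of "y * x"] hc[of "x * y - y * x"]] by blast
  qed
  then have "{x * y - y * x | x y. x \<in> Xi_prods \<and> y \<in> Xi_prods} \<subseteq> a_kernel Free4 B ?h"
    unfolding a_kernel_def' monoid_alg_simps by blast
  then have "Xi_ideal \<subseteq> a_kernel Free4 B ?h"
    unfolding Xi_ideal_def by (rule Free4.genideal_minimal[OF id])
  then show ?thesis using x unfolding a_kernel_def' by blast
qed

lemma Xi_hom:
  assumes B: "calgebra B" and g: "g \<in> UNIV \<rightarrow> carrier B"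
    and comm: "\<And>x y. x \<in> Xi_prods \<Longrightarrow> y \<in> Xi_prods \<Longrightarrow>
      free4_hom B g x \<otimes>\<^bsub>B\<^esub> free4_hom B g y = free4_hom B g y \<otimes>\<^bsub>B\<^esub> free4_hom B g x"
  shows "Xi_hom B g \<in> calg_hom R_Xi B" "Xi_hom B g (\<xi> i) = g i"
proof -
  interpret B: calgebra B by fact
  let ?h = "free4_hom B g"
  have h: "?h \<in> calg_hom Free4 B" using B.free4_hom g by blast
  have e: "Xi_hom B g (Xi_ideal +>\<^bsub>Free4\<^esub> x) = ?h x" for x
    unfolding Xi_hom_def using free4_hom_Xi_ideal[OF assms]
    by (intro Free4.the_elem_coset[OF Xi_ideal h _ B]) auto
  show "Xi_hom B g (\<xi> i) = g i" using e B.free4_hom[OF g] by (simp add: \<xi>_def)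
  have q: "(Xi_ideal +>\<^bsub>Free4\<^esub> x) \<oplus>\<^bsub>R_Xi\<^esub> (Xi_ideal +>\<^bsub>Free4\<^esub> y) = Xi_ideal +>\<^bsub>Free4\<^esub> (x + y)"
    "(Xi_ideal +>\<^bsub>Free4\<^esub> x) \<otimes>\<^bsub>R_Xi\<^esub> (Xi_ideal +>\<^bsub>Free4\<^esub> y) = Xi_ideal +>\<^bsub>Free4\<^esub> (x * y)"
    "c \<odot>\<^bsub>R_Xi\<^esub> (Xi_ideal +>\<^bsub>Free4\<^esub> x) = Xi_ideal +>\<^bsub>Free4\<^esub> (Poly_Mapping.single 0 c * x)"
    "\<one>\<^bsub>R_Xi\<^esub> = Xi_ideal +>\<^bsub>Free4\<^esub> 1" for c x y
    using Xi_quot_hom by (auto simp: calg_hom_def ring_hom_def)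
  show "Xi_hom B g \<in> calg_hom R_Xi B"
    using h by (auto simp: calg_hom_def ring_hom_def carrier_R_Xi q e)
qed

lemma Xi_generated: "calg_generated_by R_Xi (range \<xi>)"
  unfolding calg_generated_by_def
proof (intro conjI allI impI; (elim conjE)?)
  show "range \<xi> \<subseteq> carrier R_Xi" by (auto simp: \<xi>_def carrier_R_Xi)
  fix H assume H: "range \<xi> \<subseteq> H" "H \<subseteq> carrier R_Xi" "\<one>\<^bsub>R_Xi\<^esub> \<in> H"
    "\<forall>x\<in>H. \<forall>y\<in>H. x \<oplus>\<^bsub>R_Xi\<^esub> y \<in> H \<and> x \<otimes>\<^bsub>R_Xi\<^esub> y \<in> H"
    "\<forall>c. \<forall>x\<in>H. c \<odot>\<^bsub>R_Xi\<^esub> x \<in> H"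
  let ?q = "\<lambda>x. Xi_ideal +>\<^bsub>Free4\<^esub> x"
  have q: "?q (x + y) = ?q x \<oplus>\<^bsub>R_Xi\<^esub> ?q y" "?q (x * y) = ?q x \<otimes>\<^bsub>R_Xi\<^esub> ?q y"
    "?q (Poly_Mapping.single 0 c * x) = c \<odot>\<^bsub>R_Xi\<^esub> ?q x" "?q 1 = \<one>\<^bsub>R_Xi\<^esub>" for c x y
    using Xi_quot_hom by (auto simp: calg_hom_def ring_hom_def)
  have w: "?q (Poly_Mapping.single (Word w) 1) \<in> H" for w
  proof (induction w)
    case Nil
    then show ?case using q(4) H(3) by (simp flip: zero_free_mon_def)
  next
    case (Cons i w)
    have "Poly_Mapping.single (Word (i # w)) 1 = X i * Poly_Mapping.single (Word w) 1"
      by (simp add: X_def mult_single plus_free_mon_def)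
    moreover have "?q (X i) \<in> H" using H(1) by (auto simp: \<xi>_def)
    ultimately show ?case using q(2) H(4) Cons by simp
  qed
  have "?q F \<in> H" for F
  proof (induction F rule: poly_mapping_induct_single)
    case zero
    have "?q (Poly_Mapping.single 0 0 * 1) \<in> H" unfolding q(3) q(4) using H(3,5) by blast
    then show ?case by (simp only: single_zero mult_zero_left)
  next
    case (add k v f)
    have "?q (Poly_Mapping.single 0 v * Poly_Mapping.single k 1) \<in> H"
      unfolding q(3) using H(5) w[of "letters k"] by auto
    then have "?q (Poly_Mapping.single k v) \<in> H" by (simp add: mult_single)
    then show ?case using q(1) H(4) add by simp
  qed
  then show "H = carrier R_Xi" using H(2) by (auto simp: carrier_R_Xi)
qed

lemma \<pi>_Xi:
  "\<pi>_Xi \<in> calg_hom Poly4 R_Xi"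
  "\<pi>_Xi (Z 1) = \<xi> 1 \<otimes>\<^bsub>R_Xi\<^esub> \<xi> 3" "\<pi>_Xi (Z 2) = \<xi> 2 \<otimes>\<^bsub>R_Xi\<^esub> \<xi> 4"
  "\<pi>_Xi (Z 3) = \<xi> 1 \<otimes>\<^bsub>R_Xi\<^esub> \<xi> 4" "\<pi>_Xi (Z 4) = \<xi> 2 \<otimes>\<^bsub>R_Xi\<^esub> \<xi> 3"
proof -
  let ?q = "\<lambda>x. Xi_ideal +>\<^bsub>Free4\<^esub> x"
  let ?f = "\<lambda>i::4. if i = 1 then X 1 * X 3 else if i = 2 then X 2 * X 4
    else if i = 3 then X 1 * X 4 else X 2 * X 3"
  have q: "?q x \<oplus>\<^bsub>R_Xi\<^esub> ?q y = ?q (x + y)" "?q x \<otimes>\<^bsub>R_Xi\<^esub> ?q y = ?q (x * y)"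
    "?q x \<in> carrier R_Xi" for x y
    using Xi_quot_hom by (auto simp: calg_hom_def ring_hom_def)
  have g: "(if i = 1 then \<xi> 1 \<otimes>\<^bsub>R_Xi\<^esub> \<xi> 3 else if i = 2 then \<xi> 2 \<otimes>\<^bsub>R_Xi\<^esub> \<xi> 4
    else if i = 3 then \<xi> 1 \<otimes>\<^bsub>R_Xi\<^esub> \<xi> 4 else \<xi> 2 \<otimes>\<^bsub>R_Xi\<^esub> \<xi> 3) = ?q (?f i)" for i :: 4
    by (simp add: \<xi>_def q)
  have "?q (x * y) = ?q (y * x)" if "x \<in> Xi_prods" "y \<in> Xi_prods" for x y
  proof -
    interpret I: ideal Xi_ideal Free4 by (rule Xi_ideal)
    have "{x * y - y * x | x y. x \<in> Xi_prods \<and> y \<in> Xi_prods} \<subseteq> Xi_ideal"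
      unfolding Xi_ideal_def by (rule Free4.genideal_self) auto
    then have "x * y - y * x \<in> Xi_ideal" using that by blast
    then have "?q (x * y - y * x) = ?q 0"
      using I.a_rcos_const[of "x * y - y * x"] I.a_rcos_const[of 0] I.zero_closed by simp
    then show ?thesis using q(1)[of "x * y - y * x" "y * x"] q(1)[of 0 "y * x"] by simp
  qed
  moreover have "?f i \<in> Xi_prods" for i by (simp add: Xi_prods_def)
  ultimately have comm: "?q (?f i) \<otimes>\<^bsub>R_Xi\<^esub> ?q (?f j) = ?q (?f j) \<otimes>\<^bsub>R_Xi\<^esub> ?q (?f i)" for i j
    unfolding q by blast
  have *: "\<pi>_Xi = poly4_hom R_Xi (\<lambda>i. ?q (?f i))" unfolding \<pi>_Xi_def g ..
  show "\<pi>_Xi \<in> calg_hom Poly4 R_Xi"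
    unfolding * by (rule R_Xi.poly4_hom(1)) (use q(3) comm in blast)+
  have "\<pi>_Xi (Z i) = ?q (?f i)" for i
    unfolding * by (rule R_Xi.poly4_hom(2)) (use q(3) comm in blast)+
  then show "\<pi>_Xi (Z 1) = \<xi> 1 \<otimes>\<^bsub>R_Xi\<^esub> \<xi> 3" "\<pi>_Xi (Z 2) = \<xi> 2 \<otimes>\<^bsub>R_Xi\<^esub> \<xi> 4"
    "\<pi>_Xi (Z 3) = \<xi> 1 \<otimes>\<^bsub>R_Xi\<^esub> \<xi> 4" "\<pi>_Xi (Z 4) = \<xi> 2 \<otimes>\<^bsub>R_Xi\<^esub> \<xi> 3"
    by (simp_all add: \<xi>_def q)
qed

lemma mat2_mult: "mat2 a b c d ** mat2 a' b' c' d' =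
  mat2 (a*a' + b*c') (a*b' + b*d') (c*a' + d*c') (c*b' + d*d')"
  by (simp add: mat2_def matrix_matrix_mult_def vec_eq_iff forall_2 UNIV_2 vector_def)

lemma \<phi>t_deformed:
  shows "\<phi>t_deformed a1 a2 \<delta>1 \<delta>2 b1 b2 \<eta>1 \<eta>2 \<in> calg_hom R_Xi M2" (is ?A)
    and "\<phi>t_deformed a1 a2 \<delta>1 \<delta>2 b1 b2 \<eta>1 \<eta>2 (\<xi> i) =
      (if i = 1 then mat2 a1 \<delta>1 0 0 else if i = 2 then mat2 a2 \<delta>2 0 0
       else if i = 3 then mat2 b1 0 \<eta>1 0 else mat2 b2 0 \<eta>2 0)" (is ?B)
proof -
  let ?g = "\<lambda>i::4. if i = 1 then mat2 a1 \<delta>1 0 0 else if i = 2 then mat2 a2 \<delta>2 0 0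
       else if i = 3 then mat2 b1 0 \<eta>1 0 else mat2 b2 0 \<eta>2 0"
  have h: "free4_hom M2 ?g (x * y) = free4_hom M2 ?g x ** free4_hom M2 ?g y"
    "free4_hom M2 ?g (X i) = ?g i" for x y i
    using M2.free4_hom[of ?g] by (auto simp: calg_hom_def ring_hom_def)
  have diag: "\<exists>c. free4_hom M2 ?g x = mat2 c 0 0 0" if "x \<in> Xi_prods" for x
    using that by (auto simp: Xi_prods_def h mat2_mult)
  have comm: "free4_hom M2 ?g x ** free4_hom M2 ?g y = free4_hom M2 ?g y ** free4_hom M2 ?g x"
    if xy: "x \<in> Xi_prods" "y \<in> Xi_prods" for x y
  proof -
    obtain c d where "free4_hom M2 ?g x = mat2 c 0 0 0" "free4_hom M2 ?g y = mat2 d 0 0 0"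
      using diag xy by blast
    then show ?thesis by (simp add: mat2_mult mult.commute)
  qed
  show ?A ?B unfolding \<phi>t_deformed_def
    by (rule Xi_hom[OF calgebra_M2]; simp add: comm)+
qed

lemma \<phi>t_conv_deformed: "\<phi>t a1 a2 b1 b2 = \<phi>t_deformed a1 a2 0 0 b1 b2 0 0"
  by (simp add: \<phi>t_def \<phi>t_deformed_def)

lemma superficially_infinitesimal_deformation_\<phi>t:
  "superficially_infinitesimal_deformation R_Xi M2 \<xi>
    (\<phi>t a1 a2 b1 b2) (\<phi>t_deformed a1 a2 \<delta>1 \<delta>2 b1 b2 \<eta>1 \<eta>2)"
proof -
  have "\<exists>\<epsilon>\<in>carrier M2. \<phi>t_deformed a1 a2 \<delta>1 \<delta>2 b1 b2 \<eta>1 \<eta>2 (\<xi> i) =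
      \<phi>t a1 a2 b1 b2 (\<xi> i) \<oplus>\<^bsub>M2\<^esub> \<epsilon> \<and> \<epsilon> \<otimes>\<^bsub>M2\<^esub> \<epsilon> = \<zero>\<^bsub>M2\<^esub>" for i
    unfolding \<phi>t_conv_deformed \<phi>t_deformed
    by (rule bexI[of _ "if i = 1 then mat2 0 \<delta>1 0 0 else if i = 2 then mat2 0 \<delta>2 0 0
       else if i = 3 then mat2 0 0 \<eta>1 0 else mat2 0 0 \<eta>2 0"])
      (auto simp: mat2_mult, auto simp: mat2_def vec_eq_iff forall_2 vector_def)
  then show ?thesis
    unfolding superficially_infinitesimal_deformation_def
    using Xi_generated \<phi>t_deformed(1) by (auto simp: \<phi>t_conv_deformed)
qed

lemma \<phi>_const: "\<phi>_const c \<in> calg_hom Poly4 M2" "\<phi>_const c (Z i) = mat2 (c$i) 0 0 0"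
  unfolding \<phi>_const_def by (rule M2.poly4_hom; simp add: mat2_mult mult.commute)+

end

theory Submission
  imports Defs "HOL-Computational_Algebra.Polynomial"
begin

text \<open>
  With \<open>A = (a\<^sub>1, \<delta>\<^sub>1; a\<^sub>2, \<delta>\<^sub>2)\<close> and \<open>B = (b\<^sub>1, b\<^sub>2; \<eta>\<^sub>1, \<eta>\<^sub>2)\<close>, the descent sends \<open>z\<^sub>i\<close> to
  \<open>diag(c\<^sub>i, 0)\<close>, where \<open>(c\<^sub>1, c\<^sub>3; c\<^sub>4, c\<^sub>2) = A B\<close>. Hence \<open>z\<^sub>1z\<^sub>2 - z\<^sub>3z\<^sub>4\<close> is sent to
  \<open>diag(det A * det B, 0)\<close>, and for \<open>A = B = 1\<close> no power of it vanishes. Fixing \<open>B = 1\<close> and letting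
  \<open>A\<close> run through \<open>SL\<^sub>2\<close> yields all points of the deformed conifold with \<open>t = 1\<close>. The variety \<open>SL\<^sub>2\<close>
  is irreducible because every element is a product of four elementary matrices, so that any two
  elements lie on a polynomial curve inside \<open>SL\<^sub>2\<close>.
\<close>

section \<open>Subvarieties\<close>

lemma poly_value_single:
  "poly_value (Poly_Mapping.single m c) x = c * (\<Prod>i\<in>UNIV. x$i ^ Poly_Mapping.lookup m i)"
  by (cases "c = 0") (simp_all add: poly_value_def)

lemma poly_value_add: "poly_value (P + Q) x = poly_value P x + poly_value Q x"
proof -
  let ?S = "Poly_Mapping.keys P \<union> Poly_Mapping.keys Q"
  \<comment> \<open>Cancellation may shrink the support of \<open>P + Q\<close>, so all three sums
    are padded with zero terms to one common index set.\<close>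
  have "poly_value R x = (\<Sum>m\<in>?S. Poly_Mapping.lookup R m * (\<Prod>i\<in>UNIV. x$i ^ Poly_Mapping.lookup m i))"
    if "Poly_Mapping.keys R \<subseteq> ?S" for R
    unfolding poly_value_def using that
    by (intro sum.mono_neutral_left) (auto simp: in_keys_iff)
  from this[of P] this[of Q] this[of "P + Q"] show ?thesis
    using Poly_Mapping.keys_add[of P Q] by (simp add: lookup_add distrib_right sum.distrib)
qed

lemma poly_value_const: "poly_value (Poly_Mapping.single 0 c) x = c"
  by (simp add: poly_value_single)

lemma poly_value_linear: "poly_value (Poly_Mapping.single (Poly_Mapping.single i 1) c) x = c * x$i"
  by (simp add: poly_value_single lookup_single when_def if_distrib[of "power _"] cong: if_cong)

text \<open>Exponents add, so the product over the coordinates splits in two; this covers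
  \<open>i = j\<close> as well.\<close>

lemma poly_value_quadratic:
  "poly_value (Poly_Mapping.single (Poly_Mapping.single i 1 + Poly_Mapping.single j 1) c) x
    = c * (x$i * x$j)"
  by (simp add: poly_value_single lookup_add lookup_single when_def power_add prod.distrib
      if_distrib[of "power _"] cong: if_cong)

lemma zariski_closed_Int:
  assumes "zariski_closed S" "zariski_closed T"
  shows "zariski_closed (S \<inter> T)"
proof -
  obtain E F where "S = {x. \<forall>P\<in>E. poly_value P x = 0}" "T = {x. \<forall>P\<in>F. poly_value P x = 0}"
    using assms unfolding zariski_closed_def by blast
  then have "S \<inter> T = {x. \<forall>P\<in>E \<union> F. poly_value P x = 0}" by blast
  then show ?thesis unfolding zariski_closed_def by blast
qed

lemma zariski_closed_hypersurface: "zariski_closed {x. poly_value P x = 0}"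
  unfolding zariski_closed_def by (rule exI[of _ "{P}"]) simp

lemma zariski_closed_coordinate: "zariski_closed {x. x$i = c}"
proof -
  have "poly_value (Poly_Mapping.single (Poly_Mapping.single i 1) 1 + Poly_Mapping.single 0 (-c)) x
      = x$i - c" for x
    by (simp only: poly_value_add poly_value_linear poly_value_const) simp
  from zariski_closed_hypersurface[of "Poly_Mapping.single (Poly_Mapping.single i 1) 1
      + Poly_Mapping.single 0 (-c)", unfolded this]
  show ?thesis by simp
qed

lemma zariski_closed_quadric: "zariski_closed {x. x$i * x$j - x$k * x$l = c}"
proof -
  let ?P = "Poly_Mapping.single (Poly_Mapping.single i 1 + Poly_Mapping.single j 1) 1
    + Poly_Mapping.single (Poly_Mapping.single k 1 + Poly_Mapping.single l 1) (-1)
    + Poly_Mapping.single 0 (-c)"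
  have "poly_value ?P x = x$i * x$j - x$k * x$l - c" for x
    by (simp only: poly_value_add poly_value_quadratic poly_value_const) simp
  from zariski_closed_hypersurface[of ?P, unfolded this] show ?thesis by simp
qed

lemma poly_value_on_curve:
  fixes P :: "('n::finite \<Rightarrow>\<^sub>0 nat) \<Rightarrow>\<^sub>0 complex"
  shows "\<exists>p. \<forall>s. poly p s = poly_value P (\<chi> i. poly (\<gamma> i) s)"
  by (rule exI[of _ "\<Sum>m\<in>Poly_Mapping.keys P. [:Poly_Mapping.lookup P m:] *
      (\<Prod>i\<in>UNIV. \<gamma> i ^ Poly_Mapping.lookup m i)"])
    (simp add: poly_value_def poly_sum poly_prod poly_power)

text \<open>
  If closed sets \<open>T1\<close> and \<open>T2\<close> cover \<open>T\<close>, then restricting their equations to a curve through a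
  point outside \<open>T1\<close> and a point outside \<open>T2\<close> yields two nonzero univariate polynomials with
  product zero.
\<close>

lemma subvariety_polynomial_curves:
  fixes T :: "(complex^'n::finite) set"
  assumes closed: "zariski_closed T" and ne: "T \<noteq> {}"
    and curve: "\<And>x y. x \<in> T \<Longrightarrow> y \<in> T \<Longrightarrow> \<exists>\<gamma> :: 'n \<Rightarrow> complex poly.
      (\<forall>s. (\<chi> i. poly (\<gamma> i) s) \<in> T) \<and> (\<chi> i. poly (\<gamma> i) 0) = x \<and> (\<chi> i. poly (\<gamma> i) 1) = y"
  shows "subvariety T"
  unfolding subvariety_def
proof (intro conjI allI impI closed ne; elim conjE)
  fix T1 T2 assume c: "zariski_closed T1" "zariski_closed T2" and cover: "T \<subseteq> T1 \<union> T2"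
  show "T \<subseteq> T1 \<or> T \<subseteq> T2"
  proof (rule ccontr)
    assume "\<not> (T \<subseteq> T1 \<or> T \<subseteq> T2)"
    then obtain x y where x: "x \<in> T" "x \<notin> T1" and y: "y \<in> T" "y \<notin> T2" by blast
    obtain P where P: "poly_value P x \<noteq> 0" "\<And>z. z \<in> T1 \<Longrightarrow> poly_value P z = 0"
      using c(1) x(2) unfolding zariski_closed_def by blast
    obtain Q where Q: "poly_value Q y \<noteq> 0" "\<And>z. z \<in> T2 \<Longrightarrow> poly_value Q z = 0"
      using c(2) y(2) unfolding zariski_closed_def by blast
    obtain \<gamma> :: "'n \<Rightarrow> complex poly" where \<gamma>: "\<And>s. (\<chi> i. poly (\<gamma> i) s) \<in> T"
      "(\<chi> i. poly (\<gamma> i) 0) = x" "(\<chi> i. poly (\<gamma> i) 1) = y"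
      using curve[OF x(1) y(1)] by blast
    obtain p q where p: "\<And>s. poly p s = poly_value P (\<chi> i. poly (\<gamma> i) s)"
      and q: "\<And>s. poly q s = poly_value Q (\<chi> i. poly (\<gamma> i) s)"
      using poly_value_on_curve[of P \<gamma>] poly_value_on_curve[of Q \<gamma>] by blast
    have "poly (p * q) s = 0" for s
      using \<gamma>(1)[of s] cover P(2) Q(2) by (auto simp: p q)
    then have "p * q = 0" using poly_all_0_iff_0 by blast
    moreover have "poly p 0 \<noteq> 0" "poly q 1 \<noteq> 0" using P(1) Q(1) \<gamma> by (simp_all add: p q)
    ultimately show False by auto
  qed
qed


section \<open>Elementary factorization in \<open>SL\<^sub>2\<close>\<close>

text \<open>The entries of \<open>(1, 0; p, 1) (1, q; 0, 1) (1, 0; r, 1) (1, s; 0, 1)\<close>.\<close>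

lemma SL2_elementary_factorization:
  fixes a b c d :: "'a::field"
  assumes det: "a * d - b * c = 1"
  obtains p q r s where "a = 1 + q * r" "b = s * (1 + q * r) + q" "c = r + p * (1 + q * r)"
    "d = r * s + 1 + p * (s * (1 + q * r) + q)"
proof (cases "a = 0")
  case True
  then have bc: "b * c = - 1" using det by (simp add: minus_equation_iff)
  then have b: "b \<noteq> 0" by auto
  then have c: "c = - 1 / b" using bc by (metis nonzero_mult_div_cancel_left)
  show ?thesis
    \<comment> \<open>Values of \<open>q\<close>, \<open>r\<close>, \<open>s\<close>,
      \<open>p\<close>, in this order. Here \<open>1 + q * r = 0\<close> forces \<open>q = b\<close>
      and \<open>r = c\<close>; with \<open>s = 0\<close>, the last equation gives
      \<open>p\<close>.\<close>
    by (rule that[of b "-1/b" 0 "(d - 1) / b"]) (use True b c in \<open>auto simp: field_simps\<close>)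
next
  case False
  have d: "d = (1 + b * c) / a" using det False by (simp add: field_simps)
  show ?thesis
    \<comment> \<open>Again \<open>q\<close>, \<open>r\<close>, \<open>s\<close>, \<open>p\<close>.
      Taking \<open>q = 1\<close> forces \<open>r = a - 1\<close>; then \<open>s\<close> and
      \<open>p\<close> solve linear equations with coefficient \<open>a\<close>, and the determinant
      gives the last entry.\<close>
    by (rule that[of 1 "a - 1" "(b - 1) / a" "(c - (a - 1)) / a"])
      (use False d in \<open>auto simp: field_simps\<close>)
qed

text \<open>A product of unipotent matrices has determinant 1 for all parameters, which keeps a
  curve in the parameters inside SL2.\<close>

lemma SL2_entries_det:
  fixes p q r s :: "'a::comm_ring_1"
  shows "(1 + q * r) * (r * s + 1 + p * (s * (1 + q * r) + q))
    - (s * (1 + q * r) + q) * (r + p * (1 + q * r)) = 1"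
  by (simp add: algebra_simps)


section \<open>Descents\<close>

lemma vector_4:
  "(vector [w, x, y, z] :: 'a::zero^4)$1 = w" "(vector [w, x, y, z] :: 'a^4)$2 = x"
  "(vector [w, x, y, z] :: 'a^4)$3 = y" "(vector [w, x, y, z] :: 'a^4)$4 = z"
  by (simp_all add: vector_def)

lemma calg_hom_comp:
  assumes f: "f \<in> calg_hom A B" and g: "g \<in> calg_hom B C"
  shows "g \<circ> f \<in> calg_hom A C"
  using assms unfolding calg_hom_def ring_hom_def by (auto simp: Pi_iff)

text \<open>Agreement spreads from the variables to their powers, to monomials, and to linear
  combinations.\<close>

lemma Poly4_hom_eqI:
  assumes B: "calgebra B" and f: "f \<in> calg_hom Poly4 B" and g: "g \<in> calg_hom Poly4 B"
    and eq: "\<And>i. f (Z i) = g (Z i)"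
  shows "f = g"
proof
  fix F
  have f': "f (x + y) = f x \<oplus>\<^bsub>B\<^esub> f y" "f (x * y) = f x \<otimes>\<^bsub>B\<^esub> f y"
    "f 1 = \<one>\<^bsub>B\<^esub>" for x y
    using f by (simp_all add: calg_hom_def ring_hom_def)
  have f_smult: "f (Poly_Mapping.single 0 c * x) = c \<odot>\<^bsub>B\<^esub> f x" for c x
    using f by (simp add: calg_hom_def)
  have g': "g (x + y) = g x \<oplus>\<^bsub>B\<^esub> g y" "g (x * y) = g x \<otimes>\<^bsub>B\<^esub> g y"
    "g 1 = \<one>\<^bsub>B\<^esub>" for x y
    using g by (simp_all add: calg_hom_def ring_hom_def)
  have g_smult: "g (Poly_Mapping.single 0 c * x) = c \<odot>\<^bsub>B\<^esub> g x" for c x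
    using g by (simp add: calg_hom_def)
  have var: "f (Poly_Mapping.single (Poly_Mapping.single i n) 1)
      = g (Poly_Mapping.single (Poly_Mapping.single i n) 1)" for i n
  proof (induction n)
    case 0
    then show ?case by (simp add: f' g')
  next
    case (Suc n)
    have "(Poly_Mapping.single (Poly_Mapping.single i (Suc n)) 1 :: poly4)
        = Z i * Poly_Mapping.single (Poly_Mapping.single i n) 1"
      by (simp add: Z_def mult_single flip: single_add)
    then show ?case by (simp add: f' g' eq Suc)
  qed
  have mon: "f (Poly_Mapping.single m 1) = g (Poly_Mapping.single m 1)" for m
  \<comment> \<open>An exponent vector is itself finitely supported, so it is built up one power
    \<open>single i n\<close> at a time.\<close>
  proof (induction m rule: poly_mapping_induct_single)
    case zero
    then show ?case by (simp add: f' g')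
  next
    case (add i n m)
    have "(Poly_Mapping.single (Poly_Mapping.single i n + m) 1 :: poly4)
        = Poly_Mapping.single (Poly_Mapping.single i n) 1 * Poly_Mapping.single m 1"
      by (simp add: mult_single)
    then show ?case by (simp add: f' g' var add)
  qed
  show "f F = g F"
  proof (induction F rule: poly_mapping_induct_single)
    case zero
    have "f (Poly_Mapping.single 0 0 * 1) = g (Poly_Mapping.single 0 0 * 1)"
      by (simp only: f_smult g_smult f'(3) g'(3))
    then show ?case by simp
  next
    case (add m c F)
    have "Poly_Mapping.single m c = Poly_Mapping.single 0 c * Poly_Mapping.single m 1"
      by (simp add: mult_single)
    then show ?case by (simp only: f'(1) g'(1) f_smult g_smult mon add)
  qed
qed

text \<open>Each \<open>Z i\<close> goes to a matrix supported on its first row times one supported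
  on its first column. Only the top left entry survives: the row times the column.\<close>

lemma descent_\<phi>t_deformed:
  "descent (\<phi>t_deformed a1 a2 \<delta>1 \<delta>2 b1 b2 \<eta>1 \<eta>2) = \<phi>_const (vector
    [a1 * b1 + \<delta>1 * \<eta>1, a2 * b2 + \<delta>2 * \<eta>2, a1 * b2 + \<delta>1 * \<eta>2, a2 * b1 + \<delta>2 * \<eta>1])"
  (is "descent ?\<psi> = \<phi>_const ?c")
proof (rule Poly4_hom_eqI[OF calgebra_M2])
  show "descent ?\<psi> \<in> calg_hom Poly4 M2"
    unfolding descent_def by (rule calg_hom_comp[OF \<pi>_Xi(1) \<phi>t_deformed(1)])
  have \<xi>: "\<xi> i \<in> carrier R_Xi" for i by (auto simp: \<xi>_def carrier_R_Xi)
  have mult: "?\<psi> (\<xi> i \<otimes>\<^bsub>R_Xi\<^esub> \<xi> j) = ?\<psi> (\<xi> i) ** ?\<psi> (\<xi> j)" for i j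
    using \<phi>t_deformed(1) \<xi> by (auto simp: calg_hom_def ring_hom_def)
  show "descent ?\<psi> (Z i) = \<phi>_const ?c (Z i)" for i
    using exhaust_4[of i]
    by (elim disjE)
      (simp_all add: descent_def \<pi>_Xi mult \<phi>t_deformed(2) \<phi>_const(2) mat2_mult vector_4)
qed (rule \<phi>_const(1))

text \<open>The bound on \<open>k\<close> matters: the zeroth power goes to the identity, not to
  diag(1, 0).\<close>

lemma \<phi>_const_conifold_eq_power:
  assumes "k \<ge> 1"
  shows "\<phi>_const c (conifold_eq ^ k) = mat2 ((c$1 * c$2 - c$3 * c$4) ^ k) 0 0 0"
proof -
  have h: "\<phi>_const c (x + y) = \<phi>_const c x + \<phi>_const c y"
    "\<phi>_const c (x * y) = \<phi>_const c x ** \<phi>_const c y" for x y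
    using \<phi>_const(1)[of c] by (simp_all add: calg_hom_def ring_hom_def)
  have diff: "\<phi>_const c (x - y) = \<phi>_const c x - \<phi>_const c y" for x y
    using h(1)[of "x - y" y] by simp
  have eq: "\<phi>_const c conifold_eq = mat2 (c$1 * c$2 - c$3 * c$4) 0 0 0"
    by (simp add: conifold_eq_def diff h \<phi>_const(2) mat2_mult)
      (simp add: mat2_def vec_eq_iff forall_2)
  show ?thesis
    using assms by (induction k rule: dec_induct) (simp_all add: eq h mat2_mult)
qed

text \<open>For \<open>x\<close> in \<open>J\<close>, the cosets of \<open>x\<close> and of zero
  modulo \<open>J\<close> coincide, so the factoring map makes them coincide modulo
  \<open>I\<close>.\<close>

lemma subspace_contained_imp_subset:
  assumes A: "calgebra A" and I: "ideal I A" and J: "ideal J A"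
    and cont: "subspace_contained A I J"
  shows "J \<subseteq> I"
proof
  interpret calgebra A by fact
  interpret I: ideal I A by fact
  interpret J: ideal J A by fact
  obtain h where h: "\<And>x. x \<in> carrier A \<Longrightarrow> h (J +>\<^bsub>A\<^esub> x) = I +>\<^bsub>A\<^esub> x"
    using cont unfolding subspace_contained_def by blast
  fix x assume x: "x \<in> J"
  then have xc: "x \<in> carrier A" by (rule J.a_Hcarr)
  have "J +>\<^bsub>A\<^esub> x = J +>\<^bsub>A\<^esub> \<zero>\<^bsub>A\<^esub>"
    using J.a_rcos_const[OF x] J.a_rcos_const[OF J.zero_closed] by simp
  then have "I +>\<^bsub>A\<^esub> x = I" using h[OF xc] h[OF zero_closed] I.a_rcos_const[OF I.zero_closed] by simp
  then show "x \<in> I" using I.a_rcos_self[OF xc] by simp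
qed

text \<open>Containment would put \<open>conifold_eq ^ k\<close> in the kernel, but its image has a
  power of a nonzero number as top left entry.\<close>

lemma \<phi>_const_not_contained:
  assumes c: "c$1 * c$2 - c$3 * c$4 \<noteq> 0" and k: "k \<ge> 1"
  shows "\<not> subspace_contained Poly4 (image_ideal Poly4 M2 (\<phi>_const c)) (conifold_nbhd_ideal k)"
proof
  interpret P: calgebra Poly4 by (rule calgebra_monoid_alg)
  have "\<phi>_const c \<in> ring_hom Poly4 M2" using \<phi>_const(1) by (simp add: calg_hom_def)
  then interpret h: ring_hom_ring Poly4 M2 "\<phi>_const c"
    by (rule ring_hom_ringI2[OF P.ring_axioms M2.ring_axioms])
  assume "subspace_contained Poly4 (image_ideal Poly4 M2 (\<phi>_const c)) (conifold_nbhd_ideal k)"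
  then have "conifold_nbhd_ideal k \<subseteq> image_ideal Poly4 M2 (\<phi>_const c)"
    using h.kernel_is_ideal P.genideal_ideal[of "{conifold_eq ^ k}"]
    by (intro subspace_contained_imp_subset[OF calgebra_monoid_alg])
      (simp_all add: image_ideal_def conifold_nbhd_ideal_def)
  moreover have "conifold_eq ^ k \<in> conifold_nbhd_ideal k"
    unfolding conifold_nbhd_ideal_def using P.genideal_self[of "{conifold_eq ^ k}"] by simp
  ultimately have "conifold_eq ^ k \<in> image_ideal Poly4 M2 (\<phi>_const c)" by (rule subsetD)
  then have "\<phi>_const c (conifold_eq ^ k) = 0"
    unfolding image_ideal_def a_kernel_def' by simp
  then show False
    using c by (simp add: \<phi>_const_conifold_eq_power[OF k] mat2_def vec_eq_iff forall_2)
qed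


lemma descent_truly_deforms:
  "\<exists>a1 a2 b1 b2 \<delta>1 \<delta>2 \<eta>1 \<eta>2 :: complex.
      superficially_infinitesimal_deformation R_Xi M2 \<xi>
        (\<phi>t a1 a2 b1 b2) (\<phi>t_deformed a1 a2 \<delta>1 \<delta>2 b1 b2 \<eta>1 \<eta>2) \<and>
      (\<forall>k\<ge>1. \<not> subspace_contained Poly4
        (image_ideal Poly4 M2 (descent (\<phi>t_deformed a1 a2 \<delta>1 \<delta>2 b1 b2 \<eta>1 \<eta>2)))
        (conifold_nbhd_ideal k))"
proof (intro exI conjI allI impI)
  \<comment> \<open>The choice \<open>A = B = 1\<close>; the descent is then the point (1, 1, 0, 0),
    where the conifold equation has value 1.\<close>
  show "superficially_infinitesimal_deformation R_Xi M2 \<xi> (\<phi>t 1 0 1 0) (\<phi>t_deformed 1 0 0 1 1 0 0 1)"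
    by (rule superficially_infinitesimal_deformation_\<phi>t)
  fix k :: nat assume "k \<ge> 1"
  then show "\<not> subspace_contained Poly4
      (image_ideal Poly4 M2 (descent (\<phi>t_deformed 1 0 0 1 1 0 0 1))) (conifold_nbhd_ideal k)"
    unfolding descent_\<phi>t_deformed
    by (intro \<phi>_const_not_contained) (simp_all add: vector_4)
qed


section \<open>The parameter space\<close>

text \<open>The first condition is \<open>det A = 1\<close>, the other four say
  \<open>B = 1\<close>.\<close>

definition SL2_params :: "(complex^8) set"
  where "SL2_params = {p. p$1 * p$4 - p$3 * p$2 = 1} \<inter>
    ({p. p$5 = 1} \<inter> ({p. p$6 = 0} \<inter> ({p. p$7 = 0} \<inter> {p. p$8 = 1})))"

lemma forall_8: "(\<forall>i::8. P i) \<longleftrightarrow> P 1 \<and> P 2 \<and> P 3 \<and> P 4 \<and> P 5 \<and> P 6 \<and> P 7 \<and> P 8"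
proof -
  have "i = 1 \<or> i = 2 \<or> i = 3 \<or> i = 4 \<or> i = 5 \<or> i = 6 \<or> i = 7 \<or> i = 8" for i :: 8
  proof (induct i)
    \<comment> \<open>In this type \<open>8 = 0\<close>, so the representative 0 stands for the
      index 8.\<close>
    case (of_int z)
    then have "z = 0 \<or> z = 1 \<or> z = 2 \<or> z = 3 \<or> z = 4 \<or> z = 5 \<or> z = 6 \<or> z = 7" by auto
    then show ?case by auto
  qed
  then show ?thesis by metis
qed

lemma subvariety_SL2_params: "subvariety SL2_params"
proof (rule subvariety_polynomial_curves)
  show "zariski_closed SL2_params"
    unfolding SL2_params_def
    by (intro zariski_closed_Int zariski_closed_quadric zariski_closed_coordinate)
  have "(\<chi> i. if i = 1 \<or> i = 4 \<or> i = 5 \<or> i = 8 then 1 else 0) \<in> SL2_params"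
    by (simp add: SL2_params_def)
  then show "SL2_params \<noteq> {}" by blast
  fix x y assume x: "x \<in> SL2_params" and y: "y \<in> SL2_params"
  have xd: "x$1 * x$4 - x$3 * x$2 = 1" and yd: "y$1 * y$4 - y$3 * y$2 = 1"
    using x y by (simp_all add: SL2_params_def)
  obtain p q r s where x': "x$1 = 1 + q * r" "x$3 = s * (1 + q * r) + q"
    "x$2 = r + p * (1 + q * r)" "x$4 = r * s + 1 + p * (s * (1 + q * r) + q)"
    using SL2_elementary_factorization[OF xd] .
  obtain p' q' r' s' where y': "y$1 = 1 + q' * r'" "y$3 = s' * (1 + q' * r') + q'"
    "y$2 = r' + p' * (1 + q' * r')" "y$4 = r' * s' + 1 + p' * (s' * (1 + q' * r') + q')"
    using SL2_elementary_factorization[OF yd] .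
  \<comment> \<open>Affine interpolation of the four factorization parameters, from those of
    \<open>x\<close> at 0 to those of \<open>y\<close> at 1.\<close>
  define P Q R S where "P = [:p, p' - p:]" and "Q = [:q, q' - q:]" and "R = [:r, r' - r:]"
    and "S = [:s, s' - s:]"
  define \<gamma> :: "8 \<Rightarrow> complex poly" where "\<gamma> i =
    (if i = 1 then 1 + Q * R
     else if i = 3 then S * (1 + Q * R) + Q
     else if i = 2 then R + P * (1 + Q * R)
     else if i = 4 then R * S + 1 + P * (S * (1 + Q * R) + Q)
     else if i = 5 \<or> i = 8 then 1 else 0)" for i
  have "(\<chi> i. poly (\<gamma> i) u) \<in> SL2_params" for u
    using SL2_entries_det[of "poly Q u" "poly R u" "poly S u" "poly P u"]
    by (simp add: SL2_params_def \<gamma>_def)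
  moreover have "poly P 0 = p" "poly Q 0 = q" "poly R 0 = r" "poly S 0 = s"
    by (simp_all add: P_def Q_def R_def S_def)
  then have "(\<chi> i. poly (\<gamma> i) 0) = x"
    using x by (simp add: vec_eq_iff forall_8 \<gamma>_def SL2_params_def x')
  moreover have "poly P 1 = p'" "poly Q 1 = q'" "poly R 1 = r'" "poly S 1 = s'"
    by (simp_all add: P_def Q_def R_def S_def)
  then have "(\<chi> i. poly (\<gamma> i) 1) = y"
    using y by (simp add: vec_eq_iff forall_8 \<gamma>_def SL2_params_def y')
  ultimately show "\<exists>\<gamma> :: 8 \<Rightarrow> complex poly. (\<forall>s. (\<chi> i. poly (\<gamma> i) s) \<in> SL2_params) \<and>
      (\<chi> i. poly (\<gamma> i) 0) = x \<and> (\<chi> i. poly (\<gamma> i) 1) = y"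
    by blast
qed

lemma descents_SL2_params:
  "(\<lambda>p. descent (\<phi>t_at p)) ` SL2_params = \<phi>_const ` deformed_conifold 1"
proof -
  define f :: "complex^8 \<Rightarrow> complex^4" where "f p = vector [p$1, p$4, p$3, p$2]" for p
  have "descent (\<phi>t_at p) = \<phi>_const (f p)" if "p \<in> SL2_params" for p
    using that by (simp add: SL2_params_def \<phi>t_at_def descent_\<phi>t_deformed f_def)
  then have "(\<lambda>p. descent (\<phi>t_at p)) ` SL2_params = \<phi>_const ` f ` SL2_params"
    by (auto simp: image_image)
  also have "f ` SL2_params = deformed_conifold 1"
  proof (intro equalityI subsetI)
    fix c assume "c \<in> f ` SL2_params"
    then show "c \<in> deformed_conifold 1"
      by (auto simp: f_def SL2_params_def deformed_conifold_def vector_4)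
  next
    fix c assume c: "c \<in> deformed_conifold 1"
    define p :: "complex^8" where "p = (\<chi> i. if i = 1 then c$1 else if i = 4 then c$2
      else if i = 3 then c$3 else if i = 2 then c$4 else if i = 5 \<or> i = 8 then 1 else 0)"
    have "p \<in> SL2_params" using c by (simp add: p_def SL2_params_def deformed_conifold_def)
    moreover have "f p = c" by (simp add: f_def p_def vec_eq_iff forall_4 vector_4)
    ultimately show "c \<in> f ` SL2_params" by blast
  qed
  finally show ?thesis .
qed

lemma deformed_conifold_family:
  "\<exists>(t::complex) (T :: (complex^8) set). t \<noteq> 0 \<and> subvariety T \<and>
    (\<lambda>p. descent (\<phi>t_at p)) ` T = \<phi>_const ` deformed_conifold t"
proof (intro exI conjI)
  show "(1::complex) \<noteq> 0" by simp
qed (rule subvariety_SL2_params descents_SL2_params)+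

theorem lemma2p3:
  shows
    "(\<exists>a1 a2 b1 b2 \<delta>1 \<delta>2 \<eta>1 \<eta>2 :: complex.
        superficially_infinitesimal_deformation R_Xi M2 \<xi>
          (\<phi>t a1 a2 b1 b2) (\<phi>t_deformed a1 a2 \<delta>1 \<delta>2 b1 b2 \<eta>1 \<eta>2) \<and>
        (\<forall>k\<ge>1. \<not> subspace_contained Poly4
          (image_ideal Poly4 M2 (descent (\<phi>t_deformed a1 a2 \<delta>1 \<delta>2 b1 b2 \<eta>1 \<eta>2)))
          (conifold_nbhd_ideal k)))
     \<and> (\<exists>(t::complex) (T :: (complex^8) set). t \<noteq> 0 \<and> subvariety T \<and>
        (\<lambda>p. descent (\<phi>t_at p)) ` T = \<phi>_const ` deformed_conifold t)"
  by (rule conjI[OF descent_truly_deforms deformed_conifold_family])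

end
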